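(* For $0<q<p\le 1$, $n\in\mathbb{N}$ and $x\in[0,\infty)$, $$B_{n,p,q}^*(1;x)=1,\qquad B_{n,p,q}^*(t;x)=r_n(x),\qquad B_{n,p,q}^*(t^2;x)=x^2.$$
   Context: For $0<q<p\le 1$ and integers $n\ge k\ge 0$: $[n]_{p,q}=\frac{p^n-q^n}{p-q}$, $[n]_{p,q}!=[n]_{p,q}[n-1]_{p,q}\cdots[1]_{p,q}$ (with $[0]_{p,q}!=1$), $\left[\begin{array}{c}n\\k\end{array}\right]_{p,q}=\frac{[n]_{p,q}!}{[k]_{p,q}!\,[n-k]_{p,q}!}$, and $(1\oplus x)^n_{p,q}=\prod_{j=0}^{n-1}(p^j+q^jx)$. For $n\in\mathbb{N}=\{1,2,\dots\}$ and $x\in[0,\infty)$ set $$r_n(x)=\frac{-p^{n-1}+\sqrt{p^{2n-2}+4[n]_{p,q}\left([n]_{p,q}+p^n/q\right)x^2}}{2\left([n]_{p,q}+p^n/q\right)}\ \ge 0.$$ The King type modified $(p,q)$-Baskakov operator is $$B_{n,p,q}^*(f;x)=\sum_{k=0}^{\infty}\left[\begin{array}{c}n+k-1\\k\end{array}\right]_{p,q}p^{k+n(n-1)/2}q^{k(k-1)/2}\frac{r_n(x)^k}{(1\oplus r_n(x))^{n+k}_{p,q}}\,f\!\left(\frac{p^{n-1}[k]_{p,q}}{q^{k-1}[n]_{p,q}}\right),\qquad x\in[0,\infty).$$ $B_{n,p,q}^*(t^i;x)$ means the operator applied to the function $t\mapsto t^i$, evaluated at $x$. *)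

theory Defs
  imports Complex_Main
begin

definition pq_int :: "real \<Rightarrow> real \<Rightarrow> nat \<Rightarrow> real" where
  "pq_int p q n = (p ^ n - q ^ n) / (p - q)"

definition pq_fact :: "real \<Rightarrow> real \<Rightarrow> nat \<Rightarrow> real" where
  "pq_fact p q n = (\<Prod>i=1..n. pq_int p q i)"

definition pq_binomial :: "real \<Rightarrow> real \<Rightarrow> nat \<Rightarrow> nat \<Rightarrow> real" where
  "pq_binomial p q n k = pq_fact p q n / (pq_fact p q k * pq_fact p q (n - k))"

definition pq_oplus_power :: "real \<Rightarrow> real \<Rightarrow> real \<Rightarrow> nat \<Rightarrow> real" where
  "pq_oplus_power p q x n = (\<Prod>j<n. p ^ j + q ^ j * x)"

definition king_r :: "real \<Rightarrow> real \<Rightarrow> nat \<Rightarrow> real \<Rightarrow> real" where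
  "king_r p q n x =
     (- (p ^ (n - 1))
      + sqrt (p ^ (2 * n - 2) + 4 * pq_int p q n * (pq_int p q n + p ^ n / q) * x\<^sup>2))
     / (2 * (pq_int p q n + p ^ n / q))"

(* Both the node and the series term are meant for n \<ge> 1; natural subtraction then truncates
   only in k * (k - 1) at k = 0, where the product is 0 anyway.  The exponent k - 1 in the
   denominator of the node really is -1 at k = 0, hence the integer power. *)

definition baskakov_node :: "real \<Rightarrow> real \<Rightarrow> nat \<Rightarrow> nat \<Rightarrow> real" where
  "baskakov_node p q n k =
     (p ^ (n - 1) * pq_int p q k) / (q powi (int k - 1) * pq_int p q n)"

definition king_baskakov_term ::
    "real \<Rightarrow> real \<Rightarrow> nat \<Rightarrow> (real \<Rightarrow> real) \<Rightarrow> real \<Rightarrow> nat \<Rightarrow> real" where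
  "king_baskakov_term p q n f x k =
     pq_binomial p q (n + k - 1) k
     * p ^ (k + n * (n - 1) div 2) * q ^ (k * (k - 1) div 2)
     * (king_r p q n x ^ k / pq_oplus_power p q (king_r p q n x) (n + k))
     * f (baskakov_node p q n k)"

definition king_baskakov ::
    "real \<Rightarrow> real \<Rightarrow> nat \<Rightarrow> (real \<Rightarrow> real) \<Rightarrow> real \<Rightarrow> real" where
  "king_baskakov p q n f x = (\<Sum>k. king_baskakov_term p q n f x k)"

end

theory Submission
  imports Defs
begin

text \<open>
  Write \<open>[n]\<close> for \<open>pq_int p q n\<close>, put \<open>y = r\<^sub>n(x) \<ge> 0\<close>, and let \<open>w\<^sub>n(k)\<close> be the
  coefficient of \<open>f(t\<^sub>n(k))\<close> in the \<open>k\<close>-th term of the series, \<open>t\<^sub>n(k)\<close> being the node.  The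
  weights make sense for every real \<open>y \<ge> 0\<close>, and the moments are first computed for such \<open>y\<close>;
  the special choice of \<open>y\<close> enters only at the very end.

  Total mass 1 is proved by induction on \<open>n\<close>, without any generalized binomial series: the
  difference \<open>w\<^sub>n(k) - w\<^bsub>n+1\<^esub>(k)\<close> telescopes in \<open>k\<close>, its partial sums being an explicit positive
  multiple of \<open>y\<^bsup>K+1\<^esup> / (1 \<oplus> y)\<^bsup>n+K+1\<^esup>\<close>, with a factor that depends on \<open>n\<close> and \<open>K\<close> only
  (\<open>baskakov_tail\<close>).  This expression tends to 0 because the
  quotient of its consecutive values is bounded by a constant times \<open>(q/p)\<^bsup>K+1\<^esup>\<close>
  (\<open>baskakov_tail_tendsto_0\<close>).  So the series for \<open>n\<close> and for \<open>n + 1\<close> have the same sum, and for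
  \<open>n = 1\<close> the series itself telescopes to 1, with the same kind of remainder.

  The higher moments reduce to the mass by two shifts.  The node contributes a factor \<open>[k+1]/[n]\<close>
  that turns the binomial coefficient for \<open>n, k + 1\<close> into the one for \<open>n + 1, k\<close>; hence
  \<open>w\<^sub>n(k+1) t\<^sub>n(k+1) = y w\<^bsub>n+1\<^esub>(k)\<close> (\<open>baskakov_weight_node_Suc\<close>), and the mean is \<open>y\<close>.  Moreover
  \<open>t\<^sub>n(k+1)\<close> is an affine function of \<open>t\<^bsub>n+1\<^esub>(k)\<close> (\<open>baskakov_node_Suc\<close>), so the second moment for
  \<open>n\<close> follows from the mass and the mean for \<open>n + 1\<close>.  It equals
  \<open>(([n] + p\<^sup>n/q) y\<^sup>2 + p\<^bsup>n-1\<^esup> y) / [n]\<close>, and \<open>r\<^sub>n(x)\<close> is precisely the nonnegative root \<open>y\<close> of the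
  quadratic equation that sets this equal to \<open>x\<^sup>2\<close> (\<open>king_r_quadratic\<close>).
\<close>

section \<open>Weights and remainders\<close>

lemma choose_two_Suc: "Suc k choose 2 = (k choose 2) + k"
  by (simp add: numeral_2_eq_2)

text \<open>
  The point \<open>y\<close> is independent of \<open>n\<close> here, since the proofs compare the weights for \<open>n\<close> and
  \<open>n + 1\<close> at the same \<open>y\<close>.  The triangular exponents are written as binomial coefficients, which
  obey a recursion free of truncated subtraction and division.
\<close>

definition baskakov_weight :: "real \<Rightarrow> real \<Rightarrow> nat \<Rightarrow> real \<Rightarrow> nat \<Rightarrow> real" where
  "baskakov_weight p q n y k =
     pq_binomial p q (n + k - 1) k * p ^ (k + (n choose 2)) * q ^ (k choose 2)
     * (y ^ k / pq_oplus_power p q y (n + k))"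

text \<open>
  For \<open>0 < q < p\<close>, \<open>y \<ge> 0\<close> and \<open>n \<ge> 1\<close> this is the amount by which the partial sum up to \<open>k\<close> of the weights for \<open>n\<close> exceeds
  the one for \<open>n + 1\<close>; for \<open>n = 0\<close> it is what the partial sum for \<open>n + 1 = 1\<close> lacks to 1.
\<close>

definition baskakov_tail :: "real \<Rightarrow> real \<Rightarrow> nat \<Rightarrow> real \<Rightarrow> nat \<Rightarrow> real" where
  "baskakov_tail p q n y k =
     pq_binomial p q (n + k) k * p ^ (n choose 2) * q ^ (n + (Suc k choose 2))
     * (y ^ Suc k / pq_oplus_power p q y (n + Suc k))"

lemma pq_fact_Suc: "pq_fact p q (Suc n) = pq_fact p q n * pq_int p q (Suc n)"
  by (simp add: pq_fact_def)

lemma pq_oplus_power_Suc: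
  "pq_oplus_power p q y (Suc n) = pq_oplus_power p q y n * (p ^ n + q ^ n * y)"
  by (simp add: pq_oplus_power_def)

lemma king_baskakov_term_eq_weight:
  "king_baskakov_term p q n f x k =
     baskakov_weight p q n (king_r p q n x) k * f (baskakov_node p q n k)"
  by (simp add: king_baskakov_term_def baskakov_weight_def choose_two)

context
  fixes p q :: real
  assumes q_pos: "0 < q" and q_less_p: "q < p"
begin

section \<open>Integers and binomial coefficients with two parameters\<close>

lemma p_pos: "0 < p"
  using q_pos q_less_p by simp

lemma pq_int_0: "pq_int p q 0 = 0"
  by (simp add: pq_int_def)

lemma pq_int_pos:
  assumes "0 < n"
  shows "0 < pq_int p q n"
  using assms q_pos q_less_p by (simp add: pq_int_def power_strict_mono)

lemma pq_int_add: "pq_int p q (m + n) = p ^ n * pq_int p q m + q ^ m * pq_int p q n"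
proof -
  have "p ^ (m + n) - q ^ (m + n) = p ^ n * (p ^ m - q ^ m) + q ^ m * (p ^ n - q ^ n)"
    by (simp add: power_add algebra_simps)
  then show ?thesis
    by (simp add: pq_int_def add_divide_distrib)
qed

lemma pq_int_1: "pq_int p q (Suc 0) = 1"
  using q_less_p by (simp add: pq_int_def)

lemma pq_fact_pos: "0 < pq_fact p q n"
  unfolding pq_fact_def by (intro prod_pos) (auto intro: pq_int_pos)

lemma pq_binomial_pos: "0 < pq_binomial p q n k"
  by (simp add: pq_binomial_def pq_fact_pos)

lemma pq_binomial_n_0: "pq_binomial p q n 0 = 1"
  using pq_fact_pos[of n] by (simp add: pq_binomial_def pq_fact_def[of _ _ 0])

lemma pq_binomial_Suc:
  "pq_binomial p q (n + Suc k) (Suc k) =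
     pq_binomial p q (n + k) k * pq_int p q (n + Suc k) / pq_int p q (Suc k)"
  by (simp add: pq_binomial_def pq_fact_Suc)

lemma pq_binomial_Suc':
  "pq_binomial p q (n + k) (Suc k) =
     pq_binomial p q (n + k) k * pq_int p q n / pq_int p q (Suc k)"
  if "0 < n"
proof -
  obtain m where n: "n = Suc m"
    using \<open>0 < n\<close> by (cases n) auto
  have "pq_int p q (Suc m) \<noteq> 0"
    using pq_int_pos[of "Suc m"] by simp
  moreover have "n + k - k = Suc m" "n + k - Suc k = m"
    by (simp_all add: n)
  ultimately show ?thesis
    unfolding pq_binomial_def by (simp add: n pq_fact_Suc[of _ _ m] pq_fact_Suc[of _ _ k])
qed

lemma pq_oplus_power_pos:
  assumes "0 \<le> y"
  shows "0 < pq_oplus_power p q y n"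
  unfolding pq_oplus_power_def
  using assms p_pos q_pos by (intro prod_pos) (simp add: add_pos_nonneg)

section \<open>The remainder tends to zero\<close>

lemma baskakov_tail_pos:
  assumes "0 < y"
  shows "0 < baskakov_tail p q n y k"
  using assms p_pos q_pos
  by (simp add: baskakov_tail_def pq_binomial_pos pq_oplus_power_pos)

lemma baskakov_tail_Suc:
  "baskakov_tail p q n y (Suc k) =
    baskakov_tail p q n y k *
     (pq_int p q (n + Suc k) / pq_int p q (Suc k) *
      (q ^ Suc k * y / (p ^ (n + Suc k) + q ^ (n + Suc k) * y)))"
  unfolding baskakov_tail_def pq_binomial_Suc choose_two_Suc[of "Suc k"]
  by (simp add: power_add pq_oplus_power_Suc mult_ac)

text \<open>
  From \<open>[n+k+1] = p\<^sup>n [k+1] + q\<^bsup>k+1\<^esup> [n]\<close> and \<open>[k+1] \<ge> q\<^sup>k\<close>.  The bound is uniform in \<open>k\<close>, so this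
  factor of \<open>baskakov_tail_Suc\<close> does not disturb the geometric decay of the other one.
\<close>

lemma pq_int_ratio_le:
  "pq_int p q (n + Suc k) / pq_int p q (Suc k) \<le> p ^ n + q * pq_int p q n"
proof -
  have pos: "0 < pq_int p q (Suc k)"
    by (simp add: pq_int_pos)
  have nn: "0 \<le> pq_int p q n" for n
    using pq_int_pos[of n] pq_int_0 by (cases n) auto
  have "q ^ k \<le> pq_int p q (Suc k)"
    using pq_int_add[of k 1] nn[of k] p_pos by (simp add: pq_int_1)
  then have "q ^ Suc k * pq_int p q n \<le> q * pq_int p q n * pq_int p q (Suc k)"
    using mult_right_mono[of "q ^ k" "pq_int p q (Suc k)" "q * pq_int p q n"] nn[of n] q_pos
    by (simp add: mult_ac)
  then have "pq_int p q (n + Suc k) \<le> (p ^ n + q * pq_int p q n) * pq_int p q (Suc k)"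
    using pq_int_add[of "Suc k" n] by (simp add: add.commute algebra_simps)
  then show ?thesis
    using pos by (simp add: pos_divide_le_eq)
qed

text \<open>
  For \<open>y > 0\<close> the quotient of consecutive values is at most \<open>c (q/p)\<^bsup>k+1\<^esup>\<close>, as one sees by dropping the
  summand with \<open>y\<close> from \<open>p\<^bsup>n+k+1\<^esup> + q\<^bsup>n+k+1\<^esup> y\<close>.  This is where \<open>q < p\<close> makes the series converge.
\<close>

lemma baskakov_tail_tendsto_0:
  assumes "0 \<le> y"
  shows "baskakov_tail p q n y \<longlonglongrightarrow> 0"
proof (cases "y = 0")
  case True
  then show ?thesis
    by (simp add: baskakov_tail_def[abs_def])
next
  case False
  with assms have y: "0 < y" by simp
  define c where "c = (p ^ n + q * pq_int p q n) * (y / p ^ n)"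
  have "(\<lambda>k. (q / p) ^ Suc k) \<longlonglongrightarrow> 0"
    by (intro LIMSEQ_Suc LIMSEQ_power_zero) (use q_pos q_less_p in simp)
  then have "(\<lambda>k. c * (q / p) ^ Suc k) \<longlonglongrightarrow> 0"
    by (rule tendsto_mult_right_zero)
  then have "\<forall>\<^sub>F k in sequentially. c * (q / p) ^ Suc k < 1 / 2"
    by (rule order_tendstoD) simp
  then obtain N where N: "\<And>k. N \<le> k \<Longrightarrow> c * (q / p) ^ Suc k < 1 / 2"
    by (auto simp: eventually_sequentially)
  have "summable (baskakov_tail p q n y)"
  proof (rule summable_ratio_test)
    fix k assume "N \<le> k"
    let ?r = "pq_int p q (n + Suc k) / pq_int p q (Suc k)"
    let ?s = "q ^ Suc k * y / (p ^ (n + Suc k) + q ^ (n + Suc k) * y)"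
    have "?s \<le> q ^ Suc k * y / p ^ (n + Suc k)"
      using y p_pos q_pos by (intro divide_left_mono) (auto intro!: mult_pos_pos add_pos_pos)
    also have "\<dots> = y / p ^ n * (q / p) ^ Suc k"
      by (simp add: power_add power_divide mult_ac)
    finally have s: "?s \<le> y / p ^ n * (q / p) ^ Suc k" .
    have s0: "0 \<le> ?s"
      using y p_pos q_pos by simp
    have r0: "0 \<le> ?r"
      by (intro divide_nonneg_nonneg less_imp_le pq_int_pos) auto
    have "?r * ?s \<le> (p ^ n + q * pq_int p q n) * (y / p ^ n * (q / p) ^ Suc k)"
      by (intro mult_mono pq_int_ratio_le s s0 order_trans[OF r0 pq_int_ratio_le])
    also have "\<dots> = c * (q / p) ^ Suc k"
      by (simp only: c_def mult.assoc)
    finally have "?r * ?s \<le> 1 / 2"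
      using N[OF \<open>N \<le> k\<close>] by linarith
    then have "baskakov_tail p q n y k * (?r * ?s) \<le> baskakov_tail p q n y k * (1 / 2)"
      by (rule mult_left_mono) (rule less_imp_le[OF baskakov_tail_pos[OF y]])
    then have "baskakov_tail p q n y (Suc k) \<le> 1 / 2 * baskakov_tail p q n y k"
      unfolding baskakov_tail_Suc by (simp only: mult.commute)
    then show "norm (baskakov_tail p q n y (Suc k)) \<le> 1 / 2 * norm (baskakov_tail p q n y k)"
      by (simp only: real_norm_def abs_of_pos[OF baskakov_tail_pos[OF y]])
  qed simp
  then show ?thesis
    by (rule summable_LIMSEQ_zero)
qed

section \<open>The weights have total mass one\<close>

text \<open>
  Over the common denominator \<open>[k+1] (1 \<oplus> y)\<^bsup>n+k+2\<^esup>\<close> all four terms share a factor \<open>A\<close>.  Once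
  \<open>[n+k+1]\<close> is replaced by \<open>p\<^bsup>k+1\<^esup> [n] + q\<^sup>n [k+1]\<close>, the cofactors satisfy the corresponding relation as
  polynomials, \<open>[n]\<close> and \<open>[k+1]\<close> being treated as indeterminates.
\<close>

lemma baskakov_weight_Suc_diff:
  assumes "0 < n" and y: "0 \<le> y"
  shows "baskakov_weight p q n y (Suc k) - baskakov_weight p q (Suc n) y (Suc k) =
    baskakov_tail p q n y (Suc k) - baskakov_tail p q n y k"
proof -
  define B where "B = pq_binomial p q (n + k) k"
  define i j where "i = pq_int p q n" and "j = pq_int p q (Suc k)"
  define P where "P = pq_oplus_power p q y (n + Suc k)"
  define z where "z = p ^ (n + Suc k) + q ^ (n + Suc k) * y"
  define A where "A = B * p ^ (n choose 2) * q ^ (Suc k choose 2) * y ^ Suc k / (j * P * z)"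
  have j: "j > 0" and P: "P > 0" and z: "z > 0"
    using y p_pos q_pos
    by (auto simp: j_def P_def z_def pq_int_pos intro!: pq_oplus_power_pos add_pos_nonneg)
  have nk1: "pq_int p q (n + Suc k) = p ^ Suc k * i + q ^ n * j"
    unfolding i_def j_def by (rule pq_int_add)
  have P': "pq_oplus_power p q y (Suc n + Suc k) = P * z"
    unfolding P_def z_def by (simp add: pq_oplus_power_Suc)
  have P'': "pq_oplus_power p q y (n + Suc (Suc k)) = P * z"
    unfolding P_def z_def by (simp add: pq_oplus_power_Suc)
  have w1: "baskakov_weight p q n y (Suc k) = A * (p ^ Suc k * i * z)"
    using pq_binomial_Suc'[OF \<open>0 < n\<close>, of k] j P z
    by (simp add: baskakov_weight_def A_def B_def[symmetric] i_def[symmetric] j_def[symmetric]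
        P_def[symmetric] power_add del: power_Suc) (simp add: field_simps P_def power_add)
  have w2: "baskakov_weight p q (Suc n) y (Suc k) =
      A * (p ^ (Suc k + n) * (p ^ Suc k * i + q ^ n * j))"
    unfolding baskakov_weight_def P' choose_two_Suc[of n]
    using pq_binomial_Suc[of n k] j P z
    by (simp add: A_def B_def[symmetric] nk1[unfolded add_Suc_right] j_def[symmetric]
        power_add del: power_Suc) (simp add: field_simps power_add)
  have t1: "baskakov_tail p q n y (Suc k) =
      A * (q ^ (n + Suc k) * y * (p ^ Suc k * i + q ^ n * j))"
    unfolding baskakov_tail_def P'' choose_two_Suc[of "Suc k"] pq_binomial_Suc nk1
      B_def[symmetric] j_def[symmetric] A_def
    using j P z by (simp add: power_add field_simps)
  have t2: "baskakov_tail p q n y k = A * (q ^ n * j * z)"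
    unfolding baskakov_tail_def P_def[symmetric] B_def[symmetric] A_def
    using j P z by (simp add: power_add field_simps)
  have "p ^ Suc k * i * z - p ^ (Suc k + n) * (p ^ Suc k * i + q ^ n * j) =
     q ^ (n + Suc k) * y * (p ^ Suc k * i + q ^ n * j) - q ^ n * j * z"
    unfolding z_def power_add by algebra
  then show ?thesis
    unfolding w1 w2 t1 t2 by (simp only: right_diff_distrib[symmetric])
qed

lemma sum_baskakov_weight_diff:
  assumes "0 < n" and y: "0 \<le> y"
  shows "(\<Sum>k\<le>K. baskakov_weight p q n y k - baskakov_weight p q (Suc n) y k) =
    baskakov_tail p q n y K"
proof (induction K)
  case 0
  define P z where "P = pq_oplus_power p q y n" and "z = p ^ n + q ^ n * y"
  have P: "P > 0" and z: "z > 0"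
    using y p_pos q_pos by (auto simp: P_def z_def intro!: pq_oplus_power_pos add_pos_nonneg)
  have P': "pq_oplus_power p q y (Suc n) = P * z"
    unfolding P_def z_def by (rule pq_oplus_power_Suc)
  have w: "baskakov_weight p q n y 0 = p ^ (n choose 2) * z / (P * z)"
    using z by (simp add: baskakov_weight_def pq_binomial_n_0 P_def binomial_eq_0)
  have w': "baskakov_weight p q (Suc n) y 0 = p ^ (n choose 2) * p ^ n / (P * z)"
    by (simp add: baskakov_weight_def pq_binomial_n_0 P' choose_two_Suc power_add binomial_eq_0)
  have t: "baskakov_tail p q n y 0 = p ^ (n choose 2) * (q ^ n * y) / (P * z)"
    by (simp add: baskakov_tail_def pq_binomial_n_0 P' binomial_eq_0)
  have "baskakov_weight p q n y 0 - baskakov_weight p q (Suc n) y 0 = baskakov_tail p q n y 0"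
    unfolding w w' t diff_divide_distrib[symmetric] right_diff_distrib[symmetric]
    by (simp only: z_def add_diff_cancel_left')
  then show ?case
    by simp
next
  case (Suc K)
  then show ?case
    unfolding sum.atMost_Suc baskakov_weight_Suc_diff[OF assms] by linarith
qed

text \<open>
  The induction on \<open>n\<close> starts here: for \<open>n = 1\<close> all binomial coefficients are 1, and the weight is
  \<open>T\<^sub>k - T\<^bsub>k+1\<^esub>\<close> with \<open>T\<^sub>k = q\<^bsup>k(k-1)/2\<^esup> y\<^sup>k / (1 \<oplus> y)\<^sup>k\<close> and \<open>T\<^sub>0 = 1\<close>.
\<close>

lemma sum_baskakov_weight_1:
  assumes y: "0 \<le> y"
  shows "(\<Sum>k\<le>K. baskakov_weight p q (Suc 0) y k) = 1 - baskakov_tail p q 0 y K"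
proof (induction K)
  case 0
  have "1 + y > 0" using y by simp
  then show ?case
    by (simp add: baskakov_weight_def baskakov_tail_def pq_binomial_n_0 pq_oplus_power_def
      binomial_eq_0 field_simps)
next
  case (Suc K)
  have b: "pq_binomial p q k k = 1" for k
    using pq_fact_pos[of k] pq_fact_pos[of 0] by (simp add: pq_binomial_def pq_fact_def[of _ _ 0])
  define P where "P = pq_oplus_power p q y (Suc K)"
  define z where "z = p ^ Suc K + q ^ Suc K * y"
  have P: "P > 0" and z: "z > 0"
    using y p_pos q_pos
    by (auto simp: P_def z_def intro!: pq_oplus_power_pos add_pos_nonneg)
  have P': "pq_oplus_power p q y (Suc (Suc K)) = P * z"
    unfolding P_def z_def by (rule pq_oplus_power_Suc)
  have w: "baskakov_weight p q (Suc 0) y (Suc K) =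
     q ^ (Suc K choose 2) * y ^ Suc K * p ^ Suc K / (P * z)"
    using P' by (simp add: baskakov_weight_def b binomial_eq_0)
  have t1: "baskakov_tail p q 0 y (Suc K) =
     q ^ (Suc K choose 2) * y ^ Suc K * (q ^ Suc K * y) / (P * z)"
    using P' by (simp add: baskakov_tail_def b binomial_eq_0 choose_two_Suc[of "Suc K"] power_add)
  have t2: "baskakov_tail p q 0 y K = q ^ (Suc K choose 2) * y ^ Suc K * z / (P * z)"
    using z by (simp add: baskakov_tail_def b binomial_eq_0 P_def)
  have "baskakov_tail p q 0 y K =
     baskakov_weight p q (Suc 0) y (Suc K) + baskakov_tail p q 0 y (Suc K)"
    unfolding w t1 t2 add_divide_distrib[symmetric] distrib_left[symmetric] z_def ..
  with Suc show ?case by simp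
qed

lemma baskakov_weight_sums_1:
  assumes "1 \<le> n" and y: "0 \<le> y"
  shows "baskakov_weight p q n y sums 1"
  using assms(1)
proof (induction n rule: nat_induct_at_least)
  case base
  have "(\<lambda>K. 1 - baskakov_tail p q 0 y K) \<longlonglongrightarrow> 1 - 0"
    by (intro tendsto_intros baskakov_tail_tendsto_0 y)
  then show ?case
    by (simp add: sums_def_le sum_baskakov_weight_1[OF y])
next
  case (Suc n)
  have "(\<lambda>k. baskakov_weight p q n y k - baskakov_weight p q (Suc n) y k) sums 0"
    using Suc.hyps baskakov_tail_tendsto_0[OF y, of n]
    by (simp add: sums_def_le sum_baskakov_weight_diff[OF _ y])
  from sums_diff[OF Suc.IH this] show ?case
    by simp
qed

section \<open>First and second moment\<close>

lemma baskakov_node_0: "baskakov_node p q n 0 = 0"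
  by (simp add: baskakov_node_def pq_int_0)

text \<open>
  The analogue of absorbing \<open>k/n\<close> into a negative binomial coefficient.  The powers match as well:
  dividing by \<open>q\<^sup>k\<close> lowers the triangular exponent of \<open>q\<close> from \<open>k + 1\<close> to \<open>k\<close>, and the factor
  \<open>p\<^bsup>n-1\<^esup>\<close> together with one \<open>p\<close> from \<open>p\<^bsup>k+1\<^esup>\<close> raises that of \<open>p\<close> from \<open>n\<close> to \<open>n + 1\<close>.
\<close>

lemma baskakov_weight_node_Suc:
  assumes "1 \<le> n"
  shows "baskakov_weight p q n y (Suc k) * baskakov_node p q n (Suc k) =
    y * baskakov_weight p q (Suc n) y k"
proof -
  obtain m where n: "n = Suc m"
    using assms by (cases n) auto
  have "pq_int p q n > 0" "pq_int p q (Suc k) > 0"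
    using assms by (auto intro: pq_int_pos)
  then show ?thesis
    using pq_binomial_Suc'[of n k] assms q_pos
    by (simp add: baskakov_weight_def baskakov_node_def choose_two_Suc power_add)
       (simp add: n field_simps)
qed

text \<open>
  Of the two recursions for \<open>[k+1]\<close>, it is \<open>[k+1] = q\<^sup>k + p [k]\<close> that makes the first summand
  independent of \<open>k\<close> after division by \<open>q\<^sup>k\<close>.
\<close>

lemma baskakov_node_Suc:
  assumes "1 \<le> n"
  shows "baskakov_node p q n (Suc k) =
    p ^ (n - 1) / pq_int p q n + pq_int p q (Suc n) / (q * pq_int p q n) * baskakov_node p q (Suc n) k"
proof -
  have n0: "pq_int p q n \<noteq> 0" and n1: "pq_int p q (Suc n) \<noteq> 0"
    using pq_int_pos[of n] pq_int_pos[of "Suc n"] assms by auto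
  have pn: "p ^ n = p * p ^ (n - 1)"
    using assms by (cases n) auto
  have k: "pq_int p q (Suc k) = q ^ k + p * pq_int p q k"
    using pq_int_add[of k 1] by (simp add: pq_int_1)
  have "baskakov_node p q n (Suc k) = p ^ (n - 1) * (q ^ k + p * pq_int p q k) / (q ^ k * pq_int p q n)"
    by (simp add: baskakov_node_def k)
  also have "\<dots> = p ^ (n - 1) / pq_int p q n + p ^ n * pq_int p q k / (q ^ k * pq_int p q n)"
    unfolding pn distrib_left add_divide_distrib using q_pos n0 by simp
  also have "p ^ n * pq_int p q k / (q ^ k * pq_int p q n) =
      pq_int p q (Suc n) / (q * pq_int p q n) * baskakov_node p q (Suc n) k"
  proof -
    have "baskakov_node p q (Suc n) k = q * (p ^ n * pq_int p q k) / (q ^ k * pq_int p q (Suc n))"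
      unfolding baskakov_node_def using q_pos by (simp add: power_int_diff)
    then show ?thesis
      using q_pos n0 n1 by simp
  qed
  finally show ?thesis .
qed

lemma baskakov_mean_sums:
  assumes "1 \<le> n" and "0 \<le> y"
  shows "(\<lambda>k. baskakov_weight p q n y k * baskakov_node p q n k) sums y"
proof -
  have "(\<lambda>k. y * baskakov_weight p q (Suc n) y k) sums (y * 1)"
    by (intro sums_mult baskakov_weight_sums_1) (use assms in auto)
  then show ?thesis
    using sums_Suc_iff[of "\<lambda>k. baskakov_weight p q n y k * baskakov_node p q n k" y]
    by (simp add: baskakov_weight_node_Suc[OF assms(1)] baskakov_node_0)
qed

lemma baskakov_second_moment_sums:
  assumes "1 \<le> n" and "0 \<le> y"
  shows "(\<lambda>k. baskakov_weight p q n y k * (baskakov_node p q n k)\<^sup>2) sums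
    (((pq_int p q n + p ^ n / q) * y\<^sup>2 + p ^ (n - 1) * y) / pq_int p q n)"
proof -
  let ?a = "p ^ (n - 1) / pq_int p q n" and ?b = "pq_int p q (Suc n) / (q * pq_int p q n)"
  let ?w = "baskakov_weight p q (Suc n) y" and ?t = "baskakov_node p q (Suc n)"
  have "(\<lambda>k. y * (?a * ?w k + ?b * (?w k * ?t k))) sums (y * (?a * 1 + ?b * y))"
    by (intro sums_mult sums_add baskakov_weight_sums_1 baskakov_mean_sums) (use assms in auto)
  also have "(\<lambda>k. y * (?a * ?w k + ?b * (?w k * ?t k))) =
      (\<lambda>k. baskakov_weight p q n y (Suc k) * (baskakov_node p q n (Suc k))\<^sup>2)"
  proof
    fix k
    have "baskakov_weight p q n y (Suc k) * (baskakov_node p q n (Suc k))\<^sup>2 =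
        y * ?w k * baskakov_node p q n (Suc k)"
      by (simp add: power2_eq_square baskakov_weight_node_Suc[OF assms(1)] mult.assoc[symmetric])
    also have "\<dots> = y * (?a * ?w k + ?b * (?w k * ?t k))"
      unfolding baskakov_node_Suc[OF assms(1)] by (simp add: algebra_simps)
    finally show "y * (?a * ?w k + ?b * (?w k * ?t k)) =
      baskakov_weight p q n y (Suc k) * (baskakov_node p q n (Suc k))\<^sup>2" by simp
  qed
  also have "y * (?a * 1 + ?b * y) =
      ((pq_int p q n + p ^ n / q) * y\<^sup>2 + p ^ (n - 1) * y) / pq_int p q n"
    using pq_int_add[of 1 n] pq_int_pos[of n] assms(1) q_pos
    by (simp add: pq_int_1 power2_eq_square field_simps)
  finally show ?thesis
    by (subst (asm) sums_Suc_iff) (simp add: baskakov_node_0)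
qed

section \<open>The modified point\<close>

lemma king_r_nonneg: "0 \<le> king_r p q n x"
  if "1 \<le> n"
proof -
  let ?c = "4 * pq_int p q n * (pq_int p q n + p ^ n / q) * x\<^sup>2"
  have pos: "0 < pq_int p q n" "0 < p ^ n / q"
    using that p_pos q_pos by (auto intro: pq_int_pos)
  have "p ^ (2 * n - 2) = (p ^ (n - 1))\<^sup>2"
    by (simp only: power_even_eq[symmetric] diff_mult_distrib2 mult_1_right)
  then have "p ^ (n - 1) \<le> sqrt (p ^ (2 * n - 2) + ?c)"
    using pos by (intro real_le_rsqrt) simp
  with pos show ?thesis
    unfolding king_r_def by (intro divide_nonneg_nonneg) auto
qed

lemma king_r_quadratic:
  assumes "1 \<le> n"
  shows "(pq_int p q n + p ^ n / q) * (king_r p q n x)\<^sup>2 + p ^ (n - 1) * king_r p q n x =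
    pq_int p q n * x\<^sup>2"
proof -
  define a b where "a = pq_int p q n + p ^ n / q" and "b = p ^ (n - 1)"
  define s where "s = sqrt (b\<^sup>2 + 4 * pq_int p q n * a * x\<^sup>2)"
  have i: "0 < pq_int p q n" and "0 < p ^ n / q"
    using assms p_pos q_pos by (auto intro: pq_int_pos)
  then have a: "a > 0" by (simp add: a_def)
  have "p ^ (2 * n - 2) = b\<^sup>2"
    by (simp only: b_def power_even_eq[symmetric] diff_mult_distrib2 mult_1_right)
  then have r: "king_r p q n x = (s - b) / (2 * a)"
    by (simp add: king_r_def a_def b_def s_def)
  have s: "s\<^sup>2 = b\<^sup>2 + 4 * pq_int p q n * a * x\<^sup>2"
    unfolding s_def using i a by simp
  have "a * ((s - b) / (2 * a))\<^sup>2 + b * ((s - b) / (2 * a)) = (s\<^sup>2 - b\<^sup>2) / (4 * a)"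
    using a by (simp add: field_simps power2_eq_square)
  also have "\<dots> = pq_int p q n * x\<^sup>2"
    unfolding s using a by simp
  finally show ?thesis
    unfolding r a_def b_def .
qed

end

theorem lemma2:
  fixes p q x :: real and n :: nat
  assumes "0 < q" and "q < p" and "p \<le> 1" and "n \<ge> 1" and "x \<ge> 0"
  shows "(summable (king_baskakov_term p q n (\<lambda>t. 1) x) \<and> king_baskakov p q n (\<lambda>t. 1) x = 1)
    \<and> (summable (king_baskakov_term p q n (\<lambda>t. t) x) \<and> king_baskakov p q n (\<lambda>t. t) x = king_r p q n x)
    \<and> (summable (king_baskakov_term p q n (\<lambda>t. t\<^sup>2) x) \<and> king_baskakov p q n (\<lambda>t. t\<^sup>2) x = x\<^sup>2)"
proof -
  note pq = assms(1,2) and n = assms(4)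
  note r = king_r_nonneg[OF pq n, of x]
  have by_sums: "summable (king_baskakov_term p q n f x) \<and> king_baskakov p q n f x = s"
    if "(\<lambda>k. baskakov_weight p q n (king_r p q n x) k * f (baskakov_node p q n k)) sums s" for f s
    using that sums_summable[OF that] sums_unique[OF that]
    by (simp add: king_baskakov_def king_baskakov_term_eq_weight[abs_def])
  have "pq_int p q n \<noteq> 0"
    using pq_int_pos[OF pq, of n] n by simp
  then have "(\<lambda>k. baskakov_weight p q n (king_r p q n x) k * (baskakov_node p q n k)\<^sup>2) sums x\<^sup>2"
    using baskakov_second_moment_sums[OF pq n r] unfolding king_r_quadratic[OF pq n] by simp
  then show ?thesis
    using baskakov_weight_sums_1[OF pq n r] baskakov_mean_sums[OF pq n r]
    by (intro conjI[OF by_sums conjI[OF by_sums by_sums]]) simp_all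
qed

end
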